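(* Let $k\ge 3$ be an integer, let $R_{k,n}^{i}(t)$ be the $k$ sequences of generalized Perrin polynomials and $V_{k,n}^{i}(t)$ the $k$ sequences of generalized Van der Laan polynomials. Then for every $1\le i\le k$ and every integer $n\ge 1$, $$R_{k,n}^{i}(t)=\sum_{m=2}^{k} m\,t_m\,V_{k,n-m}^{i}(t)=k\,t_kV_{k,n-k}^{i}(t)+\cdots+3t_3V_{k,n-3}^{i}(t)+2t_2V_{k,n-2}^{i}(t).$$
   Context: Let $k\ge 3$ and let $t_2,\dots,t_k$ be independent indeterminates over $\mathbb{Q}$ (with $t_1=0$); everything takes place in the field $\mathbb{Q}(t_2,\dots,t_k)$. Generalized Van der Laan polynomials: for $1\le i\le k$, the sequence $V_{k,n}^{i}(t)$, $n\ge 1-k$, is defined by $V_{k,n}^{i}(t)=1$ if $n=i-k$ and $V_{k,n}^{i}(t)=0$ otherwise, for $1-k\le n\le 0$, and $V_{k,n}^{i}(t)=\sum_{j=2}^{k}t_jV_{k,n-j}^{i}(t)$ for $n>0$. Let $V_{(k)}$ be the $k\times k$ matrix with $1$'s on the superdiagonal, last row $(t_k,t_{k-1},\dots,t_2,0)$, and all other entries $0$. It is invertible. Let $w=(w_1,\dots,w_k)$ be the row vector with $w_j=-j\,t_{k-j}$ for $1\le j\le k-2$, $w_{k-1}=0$, $w_k=k$, i.e. $w=(-t_{k-1},-2t_{k-2},\dots,-(k-2)t_2,0,k)$. Let $R_{(k)}$ be the $k\times k$ matrix whose $r$-th row is $w\,(V_{(k)})^{-(k-r)}$ for $1\le r\le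 k$ (so the last row is $w$). Generalized Perrin polynomials: for $1\le i\le k$, the sequence $R_{k,n}^{i}(t)$, $n\ge 1-k$, is defined by letting $R_{k,n}^{i}(t)$ be the $(k+n,i)$ entry of $R_{(k)}$ for $1-k\le n\le 0$, and $R_{k,n}^{i}(t)=\sum_{j=2}^{k}t_jR_{k,n-j}^{i}(t)$ for $n>0$. *)

theory Defs
  imports
    "HOL-Library.Poly_Mapping"
    "HOL-Computational_Algebra.Fraction_Field"
    "Jordan_Normal_Form.Determinant"
    "Jordan_Normal_Form.Gauss_Jordan_Elimination"
begin

text \<open>
  Multivariate polynomials over the rationals are finitely supported maps from monomials to
  coefficients, a monomial being a finitely supported map from variable indices to exponents.
  The ambient field has one indeterminate for every natural number; as types cannot depend
  on \<open>k\<close>, the field of rational functions in \<open>t\<^sub>2, \<dots>, t\<^sub>k\<close> is used as a subfield of it.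
\<close>

type_synonym ratfun = "((nat \<Rightarrow>\<^sub>0 nat) \<Rightarrow>\<^sub>0 rat) fract"

definition indet :: "nat \<Rightarrow> ratfun" where
  "indet j = Fract (Poly_Mapping.single (Poly_Mapping.single j 1) 1) 1"

text \<open>
  The sequences are defined for arbitrary parameters \<open>t 2, \<dots>, t k\<close> in a field; \<open>t 0\<close> and
  \<open>t 1\<close> are never used, the convention \<open>t\<^sub>1 = 0\<close> being built in. Sequences are indexed
  by \<open>n \<ge> 1 - k\<close> and \<open>1 \<le> i \<le> k\<close>; outside this range the values carry no meaning.
\<close>

function van_der_laan :: "(nat \<Rightarrow> 'a::field) \<Rightarrow> nat \<Rightarrow> nat \<Rightarrow> int \<Rightarrow> 'a" where
  "van_der_laan t k i n =
     (if n > 0 then \<Sum>j=2..k. t j * van_der_laan t k i (n - int j)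
      else if n = int i - int k then 1 else 0)"
  by pat_completeness auto
termination
  by (relation "measure (\<lambda>(t, k, i, n). nat n)") auto

declare van_der_laan.simps [simp del]

text \<open>Matrix and vector indices start at 0, so that all subscripts below are shifted by one.\<close>

definition vdl_mat :: "(nat \<Rightarrow> 'a::field) \<Rightarrow> nat \<Rightarrow> 'a mat" where
  "vdl_mat t k = mat k k (\<lambda>(r, c).
     if r < k - 1 then (if c = r + 1 then 1 else 0)
     else if c < k - 1 then t (k - c) else 0)"

definition vdl_mat_inv :: "(nat \<Rightarrow> 'a::field) \<Rightarrow> nat \<Rightarrow> 'a mat" where
  "vdl_mat_inv t k = the (mat_inverse (vdl_mat t k))"

definition perrin_vec :: "(nat \<Rightarrow> 'a::field) \<Rightarrow> nat \<Rightarrow> 'a vec" where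
  "perrin_vec t k = vec k (\<lambda>c. let j = c + 1 in
     if j \<le> k - 2 then - of_nat j * t (k - j)
     else if j = k - 1 then 0 else of_nat k)"

definition perrin_mat :: "(nat \<Rightarrow> 'a::field) \<Rightarrow> nat \<Rightarrow> 'a mat" where
  "perrin_mat t k = mat k k (\<lambda>(r, c).
     (mat_of_row (perrin_vec t k) * vdl_mat_inv t k ^\<^sub>m (k - (r + 1))) $$ (0, c))"

function perrin :: "(nat \<Rightarrow> 'a::field) \<Rightarrow> nat \<Rightarrow> nat \<Rightarrow> int \<Rightarrow> 'a" where
  "perrin t k i n =
     (if n > 0 then \<Sum>j=2..k. t j * perrin t k i (n - int j)
      else if n \<ge> 1 - int k then perrin_mat t k $$ (nat (int k + n) - 1, i - 1)
      else 0)"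
  by pat_completeness auto
termination
  by (relation "measure (\<lambda>(t, k, i, n). nat n)") auto

declare perrin.simps [simp del]

text \<open>The indeterminates are nonzero, so \<open>vdl_mat_inv\<close> is a genuine two-sided inverse.\<close>

lemma indet_nonzero: "indet j \<noteq> 0"
proof -
  have "Poly_Mapping.single (Poly_Mapping.single j (1::nat)) (1::rat) \<noteq> 0"
    by (metis lookup_single_eq lookup_zero zero_neq_one)
  then show ?thesis
    by (simp add: indet_def Zero_fract_def eq_fract)
qed

lemma vdl_mat_inv:
  fixes t :: "nat \<Rightarrow> 'a::field"
  assumes k: "k \<ge> 2" and tk: "t k \<noteq> 0"
  shows "vdl_mat_inv t k \<in> carrier_mat k k"
    and "vdl_mat t k * vdl_mat_inv t k = 1\<^sub>m k"
    and "vdl_mat_inv t k * vdl_mat t k = 1\<^sub>m k"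
proof -
  let ?A = "vdl_mat t k"
  have A: "?A \<in> carrier_mat k k"
    by (simp add: vdl_mat_def)
  have "det ?A \<noteq> 0"
  proof
    assume "det ?A = 0"
    then obtain v where v: "v \<in> carrier_vec k" "v \<noteq> 0\<^sub>v k" "?A *\<^sub>v v = 0\<^sub>v k"
      using det_0_iff_vec_prod_zero[OF A] by blast
    have e: "(\<Sum>c<k. ?A $$ (r, c) * v $ c) = 0" if r: "r < k" for r
    proof -
      have "(?A *\<^sub>v v) $ r = (\<Sum>c<k. ?A $$ (r, c) * v $ c)"
        using A v(1) r by (auto simp: scalar_prod_def lessThan_atLeast0 intro!: sum.cong)
      then show ?thesis using v(3) r by simp
    qed
    have s: "v $ Suc r = 0" if r: "Suc r < k" for r
    proof -
      have "(\<Sum>c<k. ?A $$ (r, c) * v $ c) = (\<Sum>c<k. if c = Suc r then v $ c else 0)"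
        using r by (intro sum.cong) (auto simp: vdl_mat_def)
      then show ?thesis using e[of r] r by simp
    qed
    have "(\<Sum>c<k. ?A $$ (k - 1, c) * v $ c) = (\<Sum>c<k. if c = 0 then t k * v $ 0 else 0)"
    proof (rule sum.cong)
      fix c assume "c \<in> {..<k}"
      then show "?A $$ (k - 1, c) * v $ c = (if c = 0 then t k * v $ 0 else 0)"
        using k s by (cases c) (auto simp: vdl_mat_def)
    qed simp
    then have "v $ 0 = 0" using e[of "k - 1"] k tk by simp
    then have "v = 0\<^sub>v k"
      using v(1) s by (intro eq_vecI) (auto, metis not0_implies_Suc)
    with v(2) show False by simp
  qed
  then obtain B where B: "mat_inverse ?A = Some B"
    using mat_inverse(1)[OF A, of "()"] det_non_zero_imp_unit[OF A, of "()"]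
    by (cases "mat_inverse ?A") auto
  from mat_inverse(2)[OF A B] show "vdl_mat_inv t k \<in> carrier_mat k k"
    "?A * vdl_mat_inv t k = 1\<^sub>m k" "vdl_mat_inv t k * ?A = 1\<^sub>m k"
    by (simp_all add: vdl_mat_inv_def B)
qed

end

theory Submission
  imports Defs
begin

text \<open>
  Collect each family of \<open>k\<close> sequences into rows \<open>v\<^sub>n = (V\<^sup>1\<^sub>n, \<dots>, V\<^sup>k\<^sub>n)\<close> and
  \<open>\<rho>\<^sub>n = (R\<^sup>1\<^sub>n, \<dots>, R\<^sup>k\<^sub>n)\<close>, and let \<open>A\<close> be the companion matrix. The
  initial rows \<open>v\<^bsub>1-k\<^esub>, \<dots>, v\<^sub>0\<close> are the standard basis, \<open>A\<close> moves each of them to the next,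
  and \<open>v\<^sub>0 A\<close> is the last row of \<open>A\<close>, which is \<open>v\<^sub>1\<close>; by linearity of the recurrence,
  \<open>v\<^bsub>n+1\<^esub> = v\<^sub>n A\<close> for all \<open>n \<ge> 1 - k\<close> (\<open>van_der_laan_step\<close>).

  The Perrin rows satisfy \<open>\<rho>\<^bsub>n+1\<^esub> = \<rho>\<^sub>n A\<close> for \<open>n < 0\<close> by construction, since they are
  \<open>w\<close> times powers of \<open>A\<^sup>-\<^sup>1\<close>. That this persists for \<open>n \<ge> 0\<close>, where they are defined by the
  recurrence instead, is the Cayley-Hamilton theorem for \<open>A\<close>. It comes here from expanding
  \<open>\<rho>\<^bsub>1-k\<^esub>\<close> in the basis of initial Van der Laan rows, which makes \<open>\<rho>\<^sub>n\<close> a fixed linear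
  combination of the shifted rows \<open>v\<^sub>n, \<dots>, v\<^bsub>n+k-1\<^esub>\<close> (\<open>perrin_conv_van_der_laan\<close>).

  Both sides of the identity are therefore orbits of \<open>A\<close>, and it is enough to compare them at
  \<open>n = 1\<close>. The vector \<open>w\<close> is chosen so that they agree there: the entry of \<open>w A\<close> at
  position \<open>k + 1 - m\<close> is \<open>-(k - m) t\<^sub>m + k t\<^sub>m = m t\<^sub>m\<close>.
\<close>

text \<open>
  The \<open>i\<close>-th entry of \<open>x A\<close> for a row \<open>x\<close> and the companion matrix \<open>A\<close>, with entries counted
  from 1. Rows are functions so that sequences of rows need no conversion to vectors.
\<close>

definition companion_act :: "(nat \<Rightarrow> 'a::field) \<Rightarrow> nat \<Rightarrow> (nat \<Rightarrow> 'a) \<Rightarrow> nat \<Rightarrow> 'a" where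
  "companion_act t k x i =
     (if i = 1 then 0 else x (i - 1)) + (if i < k then t (k + 1 - i) * x k else 0)"

lemma companion_act_sum:
  "companion_act t k (\<lambda>i. \<Sum>j\<in>J. c j * X j i) i = (\<Sum>j\<in>J. c j * companion_act t k (X j) i)"
  by (simp add: companion_act_def sum.distrib sum_distrib_left algebra_simps)

lemma companion_act_cong:
  assumes "\<And>j. 1 \<le> j \<Longrightarrow> j \<le> k \<Longrightarrow> x j = y j" and "1 \<le> i" and "i \<le> k"
  shows "companion_act t k x i = companion_act t k y i"
  using assms by (auto simp: companion_act_def)

lemma van_der_laan_init:
  "n \<le> 0 \<Longrightarrow> van_der_laan t k i n = (if n = int i - int k then 1 else 0)"
  by (subst van_der_laan.simps) simp

lemma van_der_laan_rec:
  "n > 0 \<Longrightarrow> van_der_laan t k i n = (\<Sum>j=2..k. t j * van_der_laan t k i (n - int j))"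
  by (subst van_der_laan.simps) simp

lemma perrin_rec:
  "n > 0 \<Longrightarrow> perrin t k i n = (\<Sum>j=2..k. t j * perrin t k i (n - int j))"
  by (subst perrin.simps) simp

text \<open>
  At \<open>n = 0\<close> the identity says that the first computed row is the last row of the companion
  matrix; before that the row is a basis vector, and after that the recurrence is applied to both
  sides.
\<close>

lemma van_der_laan_step:
  assumes "1 \<le> i" and "i \<le> k" and "n \<ge> 1 - int k"
  shows "van_der_laan t k i (n + 1) = companion_act t k (\<lambda>i. van_der_laan t k i n) i"
  using assms(3)
proof (induction "nat (n + int k)" arbitrary: n rule: less_induct)
  case less
  consider "n < 0" | "n = 0" | "n > 0" by linarith
  then show ?case
  proof cases
    case 1
    then show ?thesis
      using less.prems assms(1,2)
      by (auto simp: companion_act_def van_der_laan_init)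
  next
    case 2
    have "van_der_laan t k i 1 = (\<Sum>j=2..k. t j * van_der_laan t k i (1 - int j))"
      by (rule van_der_laan_rec) simp
    also have "\<dots> = (\<Sum>j=2..k. if j = k + 1 - i then t j else 0)"
      using assms(1,2) by (intro sum.cong) (auto simp: van_der_laan_init)
    also have "\<dots> = (if i < k then t (k + 1 - i) else 0)"
      using assms(1,2) by auto
    finally show ?thesis
      using 2 assms(1,2) by (auto simp: companion_act_def van_der_laan_init)
  next
    case 3
    have "van_der_laan t k i (n + 1) = (\<Sum>j=2..k. t j * van_der_laan t k i (n - int j + 1))"
      using 3 by (subst van_der_laan_rec) (auto simp: algebra_simps)
    also have "\<dots> = (\<Sum>j=2..k. t j * companion_act t k (\<lambda>i. van_der_laan t k i (n - int j)) i)"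
      using 3 less.prems by (intro sum.cong refl arg_cong2[where f = "(*)"] less.hyps) auto
    also have "\<dots> = companion_act t k (\<lambda>i. van_der_laan t k i n) i"
      using 3 by (simp add: van_der_laan_rec companion_act_sum)
    finally show ?thesis .
  qed
qed

lemma row_times_vdl_mat:
  assumes "M \<in> carrier_mat 1 k" and "1 \<le> i" and "i \<le> k"
  shows "(M * vdl_mat t k) $$ (0, i - 1) = companion_act t k (\<lambda>i. M $$ (0, i - 1)) i"
proof -
  obtain c where i: "i = Suc c" using assms(2) by (cases i) auto
  obtain l where k: "k = Suc l" using assms by (cases k) auto
  have "(M * vdl_mat t k) $$ (0, c) = (\<Sum>s<k. M $$ (0, s) * vdl_mat t k $$ (s, c))"
    using assms i by (auto simp: scalar_prod_def vdl_mat_def lessThan_atLeast0 intro!: sum.cong)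
  also have "\<dots> = (\<Sum>s<l. M $$ (0, s) * (if c = Suc s then 1 else 0))
      + M $$ (0, l) * (if c < l then t (k - c) else 0)"
    using assms i by (simp add: k vdl_mat_def)
  also have "(\<Sum>s<l. M $$ (0, s) * (if c = Suc s then 1 else 0)) =
      (if c = 0 then 0 else M $$ (0, c - 1))"
    using assms i k by (cases c) (auto simp: if_distrib[of "(*) _"] cong: if_cong)
  finally show ?thesis
    by (simp add: i k companion_act_def)
qed

lemma perrin_init:
  assumes "r < k" and "1 \<le> i" and "i \<le> k"
  shows "perrin t k i (- int r) =
    (mat_of_row (perrin_vec t k) * vdl_mat_inv t k ^\<^sub>m r) $$ (0, i - 1)"
proof -
  have "nat (int k - int r) - 1 = k - Suc r" using assms(1) by simp
  then show ?thesis
    using assms by (subst perrin.simps) (auto simp: perrin_mat_def)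
qed

lemma perrin_step_init:
  fixes t :: "nat \<Rightarrow> 'a::field"
  assumes k: "k \<ge> 2" "t k \<noteq> 0" and i: "1 \<le> i" "i \<le> k" and n: "1 - int k \<le> n" "n < 0"
  shows "perrin t k i (n + 1) = companion_act t k (\<lambda>i. perrin t k i n) i"
proof -
  define r where "r = nat (- n) - 1"
  have r: "n = - int (Suc r)" "n + 1 = - int r" "Suc r < k" using n by (auto simp: r_def)
  let ?w = "mat_of_row (perrin_vec t k)" and ?A = "vdl_mat t k" and ?B = "vdl_mat_inv t k"
  have w: "?w \<in> carrier_mat 1 k" by (simp add: perrin_vec_def mat_of_row_def)
  have A: "?A \<in> carrier_mat k k" by (simp add: vdl_mat_def)
  note B = vdl_mat_inv[where t = t, OF k]
  have Br: "?B ^\<^sub>m r \<in> carrier_mat k k" using B(1) by simp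
  have "?w * ?B ^\<^sub>m Suc r * ?A = ?w * (?B ^\<^sub>m r * (?B * ?A))"
    using assoc_mult_mat[OF w mult_carrier_mat[OF Br B(1)] A] assoc_mult_mat[OF Br B(1) A]
    by simp
  also have "\<dots> = ?w * ?B ^\<^sub>m r"
    using right_mult_one_mat[OF Br] B(3) by simp
  finally have "perrin t k i (n + 1) = (?w * ?B ^\<^sub>m Suc r * ?A) $$ (0, i - 1)"
    using r i by (simp add: perrin_init)
  also have "\<dots> = companion_act t k (\<lambda>i. (?w * ?B ^\<^sub>m Suc r) $$ (0, i - 1)) i"
    using w B(1) i by (intro row_times_vdl_mat) auto
  also have "\<dots> = companion_act t k (\<lambda>i. perrin t k i n) i"
    using r i by (intro companion_act_cong) (simp_all only: perrin_init)
  finally show ?thesis .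
qed

text \<open>
  At \<open>n = 1 - k\<close> this is the expansion of a row in the standard basis, and the companion matrix
  carries it up to \<open>n = 0\<close>. For \<open>n > 0\<close> all the indices \<open>n + c - 1\<close> are positive, so the right-hand
  side inherits the recurrence from each of its terms.
\<close>

lemma perrin_conv_van_der_laan:
  fixes t :: "nat \<Rightarrow> 'a::field"
  assumes k: "k \<ge> 2" "t k \<noteq> 0" and i: "1 \<le> i" "i \<le> k" and n: "n \<ge> 1 - int k"
  shows "perrin t k i n =
    (\<Sum>c=1..k. perrin t k c (1 - int k) * van_der_laan t k i (n + int c - 1))"
  using i n
proof (induction "nat (n + int k)" arbitrary: i n rule: less_induct)
  case less
  let ?x = "\<lambda>c. perrin t k c (1 - int k)"
  consider "n = 1 - int k" | "1 - int k < n" "n \<le> 0" | "n > 0" using less.prems by linarith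
  then show ?case
  proof cases
    case 1
    have "(\<Sum>c=1..k. ?x c * van_der_laan t k i (n + int c - 1)) =
        (\<Sum>c=1..k. if c = i then ?x c else 0)"
      using 1 by (intro sum.cong) (auto simp: van_der_laan_init)
    then show ?thesis using 1 less.prems by simp
  next
    case 2
    have "perrin t k i n = companion_act t k (\<lambda>i. perrin t k i (n - 1)) i"
      using perrin_step_init[where t = t and n = "n - 1", OF k less.prems(1,2)] 2 by simp
    also have "\<dots> = companion_act t k
        (\<lambda>i. \<Sum>c=1..k. ?x c * van_der_laan t k i (n - 1 + int c - 1)) i"
      using 2 less.prems by (intro companion_act_cong less.hyps) auto
    also have "\<dots> = (\<Sum>c=1..k. ?x c *
        companion_act t k (\<lambda>i. van_der_laan t k i (n - 1 + int c - 1)) i)"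
      by (rule companion_act_sum)
    also have "\<dots> = (\<Sum>c=1..k. ?x c * van_der_laan t k i (n + int c - 1))"
      using 2 less.prems
      by (intro sum.cong refl arg_cong2[where f = "(*)"])
        (subst van_der_laan_step[symmetric], auto simp: algebra_simps)
    finally show ?thesis .
  next
    case 3
    have "perrin t k i n = (\<Sum>j=2..k. t j * perrin t k i (n - int j))"
      using 3 by (rule perrin_rec)
    also have "\<dots> = (\<Sum>j=2..k. t j *
        (\<Sum>c=1..k. ?x c * van_der_laan t k i (n - int j + int c - 1)))"
      using 3 less.prems by (intro sum.cong refl arg_cong2[where f = "(*)"] less.hyps) auto
    also have "\<dots> = (\<Sum>c=1..k. \<Sum>j=2..k. ?x c *
        (t j * van_der_laan t k i (n + int c - 1 - int j)))"
      by (subst sum.swap) (simp add: sum_distrib_left algebra_simps)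
    also have "\<dots> = (\<Sum>c=1..k. ?x c * van_der_laan t k i (n + int c - 1))"
      using 3 by (intro sum.cong refl) (subst (2) van_der_laan_rec, auto simp: sum_distrib_left)
    finally show ?thesis .
  qed
qed

lemma perrin_step:
  fixes t :: "nat \<Rightarrow> 'a::field"
  assumes k: "k \<ge> 2" "t k \<noteq> 0" and i: "1 \<le> i" "i \<le> k" and n: "n \<ge> 1 - int k"
  shows "perrin t k i (n + 1) = companion_act t k (\<lambda>i. perrin t k i n) i"
proof -
  let ?x = "\<lambda>c. perrin t k c (1 - int k)"
  have "perrin t k i (n + 1) = (\<Sum>c=1..k. ?x c * van_der_laan t k i (n + int c - 1 + 1))"
    using n by (subst perrin_conv_van_der_laan[where t = t, OF k i]) (auto simp: algebra_simps)
  also have "\<dots> = (\<Sum>c=1..k. ?x c *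
      companion_act t k (\<lambda>i. van_der_laan t k i (n + int c - 1)) i)"
    using n i by (intro sum.cong refl arg_cong2[where f = "(*)"] van_der_laan_step) auto
  also have "\<dots> = companion_act t k
      (\<lambda>i. \<Sum>c=1..k. ?x c * van_der_laan t k i (n + int c - 1)) i"
    by (rule companion_act_sum[symmetric])
  also have "\<dots> = companion_act t k (\<lambda>i. perrin t k i n) i"
    using n i by (intro companion_act_cong perrin_conv_van_der_laan[where t = t, OF k, symmetric]) auto
  finally show ?thesis .
qed

text \<open>The two sides agree at \<open>n = 1\<close>: this is the only place where the entries of \<open>w\<close> matter.\<close>

lemma perrin_one:
  fixes t :: "nat \<Rightarrow> 'a::field"
  assumes k: "k \<ge> 2" "t k \<noteq> 0" and i: "1 \<le> i" "i \<le> k"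
  shows "perrin t k i 1 = (\<Sum>m=2..k. of_nat m * t m * van_der_laan t k i (1 - int m))"
proof -
  have w: "perrin t k j 0 = perrin_vec t k $ (j - 1)" if "1 \<le> j" "j \<le> k" for j
  proof -
    have "mat_of_row (perrin_vec t k) * vdl_mat_inv t k ^\<^sub>m 0 = mat_of_row (perrin_vec t k)"
      using vdl_mat_inv(1)[where t = t, OF k]
      by (simp add: right_mult_one_mat[of _ 1] perrin_vec_def mat_of_row_def)
    then show ?thesis
      using perrin_init[of 0 k j t] that by (simp add: perrin_vec_def mat_of_row_def)
  qed
  have "perrin t k i 1 = companion_act t k (\<lambda>j. perrin_vec t k $ (j - 1)) i"
    using perrin_step[where t = t and n = 0, OF k i] k companion_act_cong[OF w i] by simp
  also have "\<dots> = (if i < k then of_nat (k + 1 - i) * t (k + 1 - i) else 0)"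
    using k i
    by (auto simp: companion_act_def perrin_vec_def Let_def Suc_diff_le of_nat_diff algebra_simps)
  also have "\<dots> = (\<Sum>m=2..k. if m = k + 1 - i then of_nat m * t m else 0)"
    using i by auto
  also have "\<dots> = (\<Sum>m=2..k. of_nat m * t m * van_der_laan t k i (1 - int m))"
    using i by (intro sum.cong) (auto simp: van_der_laan_init)
  finally show ?thesis .
qed

text \<open>
  The indeterminates enter only through \<open>t k \<noteq> 0\<close>, which makes the companion matrix
  invertible, so the identity is stated over an arbitrary field.
\<close>

lemma perrin_eq_sum_van_der_laan:
  fixes t :: "nat \<Rightarrow> 'a::field"
  assumes k: "k \<ge> 2" "t k \<noteq> 0" and i: "1 \<le> i" "i \<le> k" and n: "n \<ge> 1"
  shows "perrin t k i n = (\<Sum>m=2..k. of_nat m * t m * van_der_laan t k i (n - int m))"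
  using n i
proof (induction n arbitrary: i rule: int_ge_induct)
  case base
  then show ?case using perrin_one[where t = t, OF k] by simp
next
  case (step n)
  have "perrin t k i (n + 1) = companion_act t k (\<lambda>i. perrin t k i n) i"
    using step by (intro perrin_step[where t = t, OF k]) auto
  also have "\<dots> = companion_act t k
      (\<lambda>i. \<Sum>m=2..k. of_nat m * t m * van_der_laan t k i (n - int m)) i"
    using step by (intro companion_act_cong) auto
  also have "\<dots> = (\<Sum>m=2..k. of_nat m * t m *
      companion_act t k (\<lambda>i. van_der_laan t k i (n - int m)) i)"
    by (rule companion_act_sum)
  also have "\<dots> = (\<Sum>m=2..k. of_nat m * t m * van_der_laan t k i (n + 1 - int m))"
    using step
    by (intro sum.cong refl arg_cong2[where f = "(*)"])
      (subst van_der_laan_step[symmetric], auto simp: algebra_simps)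
  finally show ?case .
qed

theorem theorem2p16:
  fixes k i :: nat and n :: int
  assumes "k \<ge> 3" and "1 \<le> i" and "i \<le> k" and "n \<ge> 1"
  shows "perrin indet k i n =
    (\<Sum>m=2..k. of_nat m * indet m * van_der_laan indet k i (n - int m))"
  using assms by (intro perrin_eq_sum_van_der_laan indet_nonzero) auto

end
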